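(* Let $E\subset\mathbb{T}$ be a nonempty closed set, let $\rho>0$, and let $Z=\{z_n\}_{n\ge1}\subset\mathbb{D}$ (points listed with repetitions allowed according to multiplicity) satisfy $$K:=\sum_{n\ge1}(1-|z_n|)\,d^{\rho}(z_n,E)<\infty .$$ Then there exists an analytic function $f\in\mathcal{H}(\rho+1,E)$ such that $Z(f)=Z$.
   Context: $\mathbb{D}=\{z\in\mathbb{C}:|z|<1\}$ and $\mathbb{T}=\{t\in\mathbb{C}:|t|=1\}$. For $z\in\mathbb{C}$ and a set $E$, $d(z,E)=\inf_{e\in E}|z-e|$ is the Euclidean distance, and $d^{\rho}(z,E)=(d(z,E))^{\rho}$. For $\sigma>0$ and a closed set $E\subset\mathbb{T}$, $\mathcal{H}(\sigma,E)$ is the class of analytic functions $f$ in $\mathbb{D}$ for which there is a constant $C>0$ with $$|f(z)|\le\exp\left(\frac{C}{d^{\sigma}(z,E)}\right),\qquad z\in\mathbb{D}.$$ $Z(f)$ denotes the zero set of $f$ in $\mathbb{D}$, each zero counted according to its multiplicity; the equality $Z(f)=Z$ is understood with multiplicities (in particular $f\not\equiv0$). *)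

theory Defs
  imports "HOL-Complex_Analysis.Complex_Analysis"
begin

definition growth_class :: "real \<Rightarrow> complex set \<Rightarrow> (complex \<Rightarrow> complex) set" where
  "growth_class \<sigma> E =
     {f. f holomorphic_on ball 0 1 \<and>
         (\<exists>C>0. \<forall>z\<in>ball 0 1. norm (f z) \<le> exp (C / infdist z E powr \<sigma>))}"

text \<open>
  The family \<open>(z n)\<close>, \<open>n \<in> I\<close>, lists the zeros of \<open>f\<close> in the open unit disc, each repeated according
  to its multiplicity. For \<open>f\<close> holomorphic and not identically zero on the disc, \<open>zorder f w\<close> is the
  multiplicity of \<open>w\<close> as a zero (and is \<open>0\<close> where \<open>f\<close> does not vanish). Finiteness is explicit because
  \<open>card\<close> is \<open>0\<close> on infinite sets.
\<close>
definition zeros_in_disc_are ::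
  "(complex \<Rightarrow> complex) \<Rightarrow> (nat \<Rightarrow> complex) \<Rightarrow> nat set \<Rightarrow> bool" where
  "zeros_in_disc_are f z I \<longleftrightarrow>
     (\<exists>w\<in>ball 0 1. f w \<noteq> 0) \<and>
     (\<forall>n\<in>I. z n \<in> ball 0 1) \<and>
     (\<forall>w\<in>ball 0 1. finite {n\<in>I. z n = w} \<and> zorder f w = int (card {n\<in>I. z n = w}))"

end

theory Submission
  imports Defs
begin

text \<open>
  For a zero \<open>a\<close> off the centre, with nearest point \<open>e\<close> of \<open>E\<close>, the factor at \<open>x\<close> is the
  quotient \<open>W u / W v\<close> of Weierstrass factors of genus \<open>p = \<lceil>\<rho>\<rceil>\<close> at \<open>u = (a - e) / (x - e)\<close> and
  \<open>v = (1 / cnj a - e) / (x - e)\<close>, that is, a Blaschke factor times a convergence factor with its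
  only singularity at \<open>e\<close>. Here \<open>\<bar>u - v\<bar>\<close> is of order \<open>(1 - \<bar>a\<bar>) / \<bar>x - e\<bar>\<close>, while \<open>\<bar>u\<bar>\<close> and
  \<open>\<bar>v\<bar>\<close> are at most \<open>M = 4 \<bar>a - e\<bar> / d(x, E)\<close>. If \<open>M \<le> 1/2\<close>, then \<open>W' t = - t^p exp (\<dots>)\<close> yields
  \<open>\<bar>W u / W v - 1\<bar> \<le> C M^p \<bar>u - v\<bar> \<le> C M^\<rho> \<bar>u - v\<bar>\<close>. If \<open>M > 1/2\<close>, the Blaschke part has modulus
  at most \<open>1\<close>, and the exponent, a polynomial of degree \<open>p \<le> \<rho> + 1\<close>, contributes at most
  \<open>C M^\<rho> \<bar>u - v\<bar>\<close>. In both cases the logarithm of the factor is at most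
  \<open>C (1 - \<bar>a\<bar>) \<bar>a - e\<bar>^\<rho> / d(x, E)^(\<rho> + 1)\<close>, and these bounds can be summed over the zeros.
\<close>

section \<open>Quotients of Weierstrass factors\<close>

text \<open>The Taylor polynomial of degree \<open>p\<close> of \<open>- ln (1 - t)\<close> at
  \<open>0\<close>. It is separated from the factor \<open>1 - t\<close> because for large arguments
  the two are bounded by different means.\<close>

definition weierstrass_exponent :: "nat \<Rightarrow> complex \<Rightarrow> complex" where
  "weierstrass_exponent p t = (\<Sum>k=1..p. t ^ k / of_nat k)"

lemma weierstrass_factor_eq:
  "weierstrass_factor p t = (1 - t) * exp (weierstrass_exponent p t)"
  by (simp add: weierstrass_factor_def weierstrass_exponent_def)

lemma weierstrass_exponent_holomorphic [holomorphic_intros]: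
  "f holomorphic_on A \<Longrightarrow> (\<lambda>x. weierstrass_exponent p (f x)) holomorphic_on A"
  by (auto simp: weierstrass_exponent_def intro!: holomorphic_intros)

lemma weierstrass_exponent_has_field_derivative:
  "(weierstrass_exponent p has_field_derivative (\<Sum>k<p. t ^ k)) (at t within A)"
proof -
  have "((\<lambda>t. \<Sum>k=1..p. t ^ k / of_nat k) has_field_derivative (\<Sum>k=1..p. t ^ (k - 1))) (at t within A)"
    by (rule derivative_eq_intros refl | simp)+
  also have "(\<Sum>k=1..p. t ^ (k - 1)) = (\<Sum>k<p. t ^ k)"
    by (rule sum.reindex_bij_witness[of _ Suc "\<lambda>k. k - 1"]) auto
  finally show ?thesis
    by (simp add: weierstrass_exponent_def[abs_def])
qed

text \<open>Multiplied by \<open>1 - t\<close>, the derivative of the exponent telescopes to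
  \<open>1 - t ^ p\<close>, so in the product rule only the \<open>t ^ p\<close> term survives. It
  is the source of the gain \<open>M ^ p\<close> for small arguments.\<close>

lemma weierstrass_factor_has_field_derivative:
  "(weierstrass_factor p has_field_derivative - (t ^ p * exp (weierstrass_exponent p t))) (at t within A)"
proof -
  have "((\<lambda>t. (1 - t) * exp (weierstrass_exponent p t)) has_field_derivative
      ((1 - t) * (exp (weierstrass_exponent p t) * (\<Sum>k<p. t ^ k)) - exp (weierstrass_exponent p t))) (at t within A)"
    by (rule derivative_eq_intros DERIV_fun_exp weierstrass_exponent_has_field_derivative refl | simp)+
  also have "(1 - t) * (exp (weierstrass_exponent p t) * (\<Sum>k<p. t ^ k)) - exp (weierstrass_exponent p t)
      = exp (weierstrass_exponent p t) * ((1 - t) * (\<Sum>k<p. t ^ k)) - exp (weierstrass_exponent p t)"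
    by (simp add: algebra_simps)
  also have "(1 - t) * (\<Sum>k<p. t ^ k) = 1 - t ^ p"
    by (simp add: one_diff_power_eq)
  finally show ?thesis
    by (simp add: weierstrass_factor_eq[abs_def] algebra_simps)
qed

text \<open>Mean value inequality on the disc of radius \<open>M\<close>. Only powers up to
  \<open>p - 1\<close> occur, which is what large \<open>M\<close> requires.\<close>

lemma norm_weierstrass_exponent_diff_le:
  assumes "norm u \<le> M" "norm v \<le> M"
  shows "norm (weierstrass_exponent p u - weierstrass_exponent p v) \<le> (\<Sum>k<p. M ^ k) * norm (u - v)"
proof (rule field_differentiable_bound[of "cball 0 M"])
  fix t :: complex assume "t \<in> cball 0 M"
  then have "norm (\<Sum>k<p. t ^ k) \<le> (\<Sum>k<p. norm t ^ k)"
    by (metis (no_types, lifting) norm_power norm_sum sum.cong)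
  also have "\<dots> \<le> (\<Sum>k<p. M ^ k)"
    using \<open>t \<in> cball 0 M\<close> by (intro sum_mono power_mono) auto
  finally show "norm (\<Sum>k<p. t ^ k) \<le> (\<Sum>k<p. M ^ k)" .
qed (use assms in \<open>auto intro: weierstrass_exponent_has_field_derivative\<close>)

lemma norm_weierstrass_exponent_le:
  assumes "norm t \<le> M"
  shows "norm (weierstrass_exponent p t) \<le> (\<Sum>k=1..p. M ^ k)"
proof -
  have "norm (weierstrass_exponent p t) \<le> (\<Sum>k=1..p. norm (t ^ k / of_nat k))"
    unfolding weierstrass_exponent_def by (rule norm_sum)
  also have "\<dots> \<le> (\<Sum>k=1..p. M ^ k)"
  proof (rule sum_mono)
    fix k assume "k \<in> {1..p}"
    have "norm (t ^ k / of_nat k) = norm t ^ k / real k"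
      by (simp add: norm_divide norm_power)
    also have "\<dots> \<le> norm t ^ k"
      using \<open>k \<in> {1..p}\<close> by (simp add: divide_le_eq mult_le_cancel_left1)
    also have "\<dots> \<le> M ^ k"
      using assms by (intro power_mono) auto
    finally show "norm (t ^ k / of_nat k) \<le> M ^ k" .
  qed
  finally show ?thesis .
qed

lemma norm_weierstrass_factor_diff_le:
  assumes "norm u \<le> M" "norm v \<le> M"
  shows "norm (weierstrass_factor p u - weierstrass_factor p v) \<le> M ^ p * exp (\<Sum>k=1..p. M ^ k) * norm (u - v)"
proof (rule field_differentiable_bound[of "cball 0 M"])
  fix t :: complex assume t: "t \<in> cball 0 M"
  then have "norm (exp (weierstrass_exponent p t)) \<le> exp (\<Sum>k=1..p. M ^ k)"
    using norm_weierstrass_exponent_le[of t M p] by (intro order.trans[OF norm_exp]) simp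
  then show "norm (- (t ^ p * exp (weierstrass_exponent p t))) \<le> M ^ p * exp (\<Sum>k=1..p. M ^ k)"
    using t order.trans[OF norm_ge_zero, of t M] unfolding norm_minus_cancel norm_mult norm_power
    by (intro mult_mono power_mono) auto
qed (use assms in \<open>auto intro: weierstrass_factor_has_field_derivative\<close>)

text \<open>The difference of the two factors is divided by a lower bound for the denominator. The
  sum in the exponent is doubled because it bounds the exponential from above in the numerator and
  from below in the denominator.\<close>

lemma norm_weierstrass_factor_quotient_minus_1_le:
  assumes "norm u \<le> M" "norm v \<le> M" and \<delta>: "0 < \<delta>" "\<delta> \<le> norm (1 - v)"
  shows "norm (weierstrass_factor p u / weierstrass_factor p v - 1)
    \<le> M ^ p * exp (2 * (\<Sum>k=1..p. M ^ k)) / \<delta> * norm (u - v)"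
proof -
  define S where "S = (\<Sum>k=1..p. M ^ k)"
  have "exp (- S) \<le> norm (exp (weierstrass_exponent p v))"
    using norm_weierstrass_exponent_le[OF assms(2), of p] abs_Re_le_cmod[of "weierstrass_exponent p v"]
    unfolding S_def norm_exp_eq_Re by (subst exp_le_cancel_iff) linarith
  then have W: "\<delta> * exp (- S) \<le> norm (weierstrass_factor p v)"
    using \<delta> unfolding weierstrass_factor_eq norm_mult by (intro mult_mono) auto
  have "0 < \<delta> * exp (- S)"
    using \<delta> by simp
  then have nz: "weierstrass_factor p v \<noteq> 0"
    using W by (metis norm_zero not_less)
  have "norm (weierstrass_factor p u / weierstrass_factor p v - 1)
      = norm (weierstrass_factor p u - weierstrass_factor p v) / norm (weierstrass_factor p v)"
    using nz by (metis diff_divide_distrib divide_self norm_divide)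
  also have "\<dots> \<le> (M ^ p * exp S * norm (u - v)) / (\<delta> * exp (- S))"
    using norm_weierstrass_factor_diff_le[OF assms(1,2), of p] W \<open>0 < \<delta> * exp (- S)\<close>
    unfolding S_def by (intro frac_le) (auto intro: order.trans[OF norm_ge_zero])
  also have "\<dots> = M ^ p * exp (2 * S) / \<delta> * norm (u - v)"
    using \<delta> by (simp add: exp_minus field_simps flip: exp_add)
  finally show ?thesis
    by (simp add: S_def)
qed

text \<open>Each summand of the constant serves one case: \<open>2 * exp 2\<close> the case
  \<open>M \<le> 1 / 2\<close>, where \<open>\<rho> \<le> real p\<close> gives
  \<open>M ^ p \<le> M powr \<rho>\<close>, and \<open>real p * 2 powr \<rho>\<close> the other,
  where \<open>p\<close> powers of \<open>M\<close> have exponents at most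
  \<open>p - 1 \<le> \<rho>\<close>.\<close>

lemma norm_weierstrass_factor_quotient_le:
  assumes M: "norm u \<le> M" "norm v \<le> M" "M > 0"
    and uv: "norm (1 - u) \<le> norm (1 - v)" "v \<noteq> 1"
    and \<rho>: "real p - 1 \<le> \<rho>" "\<rho> \<le> real p" "\<rho> > 0"
  shows "norm (weierstrass_factor p u / weierstrass_factor p v)
    \<le> exp ((2 * exp 2 + real p * 2 powr \<rho>) * M powr \<rho> * norm (u - v))"
proof (cases "M \<le> 1 / 2")
  case True
  have "(\<Sum>k=1..p. M ^ k) \<le> (\<Sum>k=1..p. (1 / 2) ^ k)"
    using True M by (intro sum_mono power_mono) auto
  also have "\<dots> \<le> (1::real)"
    by (induction p) (auto simp: sum_gp)
  finally have S: "(\<Sum>k=1..p. M ^ k) \<le> 1" .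
  \<comment> \<open>Here \<open>norm v \<le> 1 / 2\<close>, so \<open>\<delta> = 1 / 2\<close> is
    admissible.\<close>
  have "norm (weierstrass_factor p u / weierstrass_factor p v - 1)
      \<le> M ^ p * exp (2 * (\<Sum>k=1..p. M ^ k)) / (1 / 2) * norm (u - v)"
    using norm_triangle_ineq2[of 1 v] True M
    by (intro norm_weierstrass_factor_quotient_minus_1_le) auto
  also have "\<dots> \<le> M powr \<rho> * exp 2 / (1 / 2) * norm (u - v)"
  proof (intro mult_right_mono divide_right_mono mult_mono)
    show "M ^ p \<le> M powr \<rho>"
      using M True \<rho> powr_mono'[of \<rho> "real p" M] by (simp add: powr_realpow)
  qed (use S in auto)
  also have "\<dots> \<le> (2 * exp 2 + real p * 2 powr \<rho>) * M powr \<rho> * norm (u - v)"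
    by (intro mult_right_mono) (auto simp: algebra_simps)
  finally have "norm (weierstrass_factor p u / weierstrass_factor p v)
      \<le> 1 + (2 * exp 2 + real p * 2 powr \<rho>) * M powr \<rho> * norm (u - v)"
    using norm_triangle_ineq2[of "weierstrass_factor p u / weierstrass_factor p v" 1] by simp
  then show ?thesis
    using exp_ge_add_one_self order.trans by blast
next
  case False
  have "(\<Sum>k<p. M ^ k) \<le> (\<Sum>k<p. (2 * M) powr \<rho>)"
  proof (rule sum_mono)
    fix k assume "k \<in> {..<p}"
    \<comment> \<open>Doubling makes the base exceed \<open>1\<close>, so that raising the exponent
      from \<open>k\<close> to \<open>\<rho>\<close> increases the power.\<close>
    have "M ^ k \<le> (2 * M) ^ k"
      using M by (intro power_mono) auto
    also have "\<dots> = (2 * M) powr real k"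
      using M by (simp add: powr_realpow)
    also have "\<dots> \<le> (2 * M) powr \<rho>"
      using False \<rho> \<open>k \<in> {..<p}\<close> by (intro powr_mono) auto
    finally show "M ^ k \<le> (2 * M) powr \<rho>" .
  qed
  also have "\<dots> = real p * 2 powr \<rho> * M powr \<rho>"
    using M by (simp add: powr_mult)
  also have "\<dots> \<le> (2 * exp 2 + real p * 2 powr \<rho>) * M powr \<rho>"
    by (intro mult_right_mono) auto
  finally have S: "(\<Sum>k<p. M ^ k) * norm (u - v)
      \<le> (2 * exp 2 + real p * 2 powr \<rho>) * M powr \<rho> * norm (u - v)"
    by (rule mult_right_mono) simp
  have "norm (weierstrass_factor p u / weierstrass_factor p v)
      = norm (1 - u) / norm (1 - v) * norm (exp (weierstrass_exponent p u - weierstrass_exponent p v))"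
    by (simp add: weierstrass_factor_eq norm_mult norm_divide exp_diff)
  also have "\<dots> \<le> 1 * exp (norm (weierstrass_exponent p u - weierstrass_exponent p v))"
    using uv by (intro mult_mono norm_exp) auto
  also have "\<dots> \<le> exp ((2 * exp 2 + real p * 2 powr \<rho>) * M powr \<rho> * norm (u - v))"
    using norm_weierstrass_exponent_diff_le[OF M(1,2), of p] S by simp
  finally show ?thesis .
qed

section \<open>The factor vanishing at a given point\<close>

text \<open>The linear factor for \<open>\<bar>a\<bar> < 1/2\<close> avoids the reflected point \<open>1 / cnj a\<close> near \<open>a = 0\<close>.\<close>
definition disc_factor :: "nat \<Rightarrow> complex \<Rightarrow> complex \<Rightarrow> complex \<Rightarrow> complex" where
  "disc_factor p e a x =
     (if norm a < 1 / 2 then (x - a) / 2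
      else weierstrass_factor p ((a - e) / (x - e)) /
           weierstrass_factor p ((1 / cnj a - e) / (x - e)))"

section \<open>Geometry of a point of the disc and its reflection in the circle\<close>

lemma norm_inverse_cnj: "norm (1 / cnj a) = 1 / norm a"
  by (simp add: norm_divide)

text \<open>This is the Blaschke estimate: the squared moduli of \<open>1 - cnj a * x\<close> and
  \<open>x - a\<close> differ by \<open>(1 - (norm a)\<^sup>2) * (1 - (norm x)\<^sup>2)\<close>, and
  \<open>1 - cnj a * x\<close> is \<open>x - 1 / cnj a\<close> up to a factor of modulus below
  \<open>1\<close>.\<close>

lemma norm_diff_le_norm_diff_inverse_cnj:
  assumes "norm a < 1" "norm x < 1" "a \<noteq> 0"
  shows "norm (x - a) \<le> norm (x - 1 / cnj a)"
proof -
  have 1: "(norm (1 - cnj a * x))\<^sup>2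
      = (1 - (Re a * Re x + Im a * Im x))\<^sup>2 + (Im a * Re x - Re a * Im x)\<^sup>2"
    by (simp add: cmod_power2)
  have 2: "(norm (x - a))\<^sup>2 = (Re x - Re a)\<^sup>2 + (Im x - Im a)\<^sup>2"
    by (simp add: cmod_power2)
  have "(norm (1 - cnj a * x))\<^sup>2 - (norm (x - a))\<^sup>2 = (1 - (norm a)\<^sup>2) * (1 - (norm x)\<^sup>2)"
    unfolding 1 2 cmod_power2[of a] cmod_power2[of x] by algebra
  also have "\<dots> \<ge> 0"
    using power_le_one[of "norm a" 2] power_le_one[of "norm x" 2] assms(1,2)
    by (intro mult_nonneg_nonneg) simp_all
  finally have "norm (x - a) \<le> norm (1 - cnj a * x)"
    by (metis diff_ge_0_iff_ge norm_ge_zero power2_le_imp_le)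
  also have "1 - cnj a * x = - cnj a * (x - 1 / cnj a)"
    using assms by (simp add: field_simps)
  also have "norm \<dots> \<le> 1 * norm (x - 1 / cnj a)"
    unfolding norm_mult using assms by (intro mult_right_mono) auto
  finally show ?thesis by simp
qed

text \<open>The bound \<open>D\<close> stays free: it becomes the distance from \<open>x\<close> to
  \<open>E\<close> in the growth estimate and the distance from a smaller disc to the circle in the
  convergence estimate.\<close>

lemma
  assumes a: "1 / 2 \<le> norm a" "norm a < 1" and e: "norm e = 1" and x: "norm x < 1"
    and D: "0 < D" "D \<le> norm (x - e)"
  defines "u \<equiv> (a - e) / (x - e)" and "v \<equiv> (1 / cnj a - e) / (x - e)"
  shows norm_quotient_zero_le: "norm u \<le> 4 * norm (a - e) / D"
    and norm_quotient_pole_le: "norm v \<le> 4 * norm (a - e) / D"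
    and norm_quotient_diff_le: "norm (u - v) \<le> 3 * (1 - norm a) / D"
    and norm_one_minus_quotient_le: "norm (1 - u) \<le> norm (1 - v)"
    and norm_one_minus_pole_eq: "norm (1 - v) = norm (x - 1 / cnj a) / norm (x - e)"
    and quotient_pole_neq_1: "v \<noteq> 1"
proof -
  have xe: "x \<noteq> e" and a0: "a \<noteq> 0"
    using D a by auto
  have "norm (a - 1 / cnj a) = (1 - (norm a)\<^sup>2) / norm a"
  proof -
    have "norm (a - 1 / cnj a) = norm (a * cnj a - 1) / norm a"
    proof -
      have "a - 1 / cnj a = (a * cnj a - 1) / cnj a"
        using a0 by (simp add: diff_divide_distrib)
      then show ?thesis
        by (simp only: norm_divide complex_mod_cnj)
    qed
    also have "a * cnj a - 1 = of_real ((norm a)\<^sup>2 - 1)"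
      by (simp only: complex_norm_square of_real_diff of_real_1)
    also have "norm \<dots> = 1 - (norm a)\<^sup>2"
      using a power_le_one[of "norm a" 2] unfolding norm_of_real by linarith
    finally show ?thesis .
  qed
  also have "\<dots> = (1 + norm a) / norm a * (1 - norm a)"
    by (simp add: power2_eq_square field_simps)
  \<comment> \<open>The quotient is \<open>1 + 1 / norm a\<close>, and
    \<open>norm a \<ge> 1 / 2\<close>.\<close>
  also have "\<dots> \<le> 3 * (1 - norm a)"
    using a a0 by (intro mult_right_mono) (auto simp: divide_le_eq)
  finally have refl: "norm (a - 1 / cnj a) \<le> 3 * (1 - norm a)" .
  have "1 - norm a \<le> norm (a - e)"
    using e norm_triangle_ineq2[of e a] by (simp add: norm_minus_commute)
  \<comment> \<open>The reflection moves \<open>a\<close> by at most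
    \<open>3 * norm (a - e)\<close>, hence the constant \<open>4\<close>.\<close>
  then have pole: "norm (1 / cnj a - e) \<le> 4 * norm (a - e)"
    using refl norm_triangle_ineq[of "1 / cnj a - a" "a - e"] by (simp add: norm_minus_commute)
  show "norm u \<le> 4 * norm (a - e) / D"
    unfolding u_def norm_divide using D by (intro frac_le) auto
  show "norm v \<le> 4 * norm (a - e) / D"
    unfolding v_def norm_divide using D pole by (intro frac_le) auto
  have "u - v = (a - 1 / cnj a) / (x - e)"
    by (simp add: u_def v_def diff_divide_distrib)
  then show "norm (u - v) \<le> 3 * (1 - norm a) / D"
    using D refl a by (simp only: norm_divide) (intro frac_le, auto)
  have "1 - (c - e) / (x - e) = (x - c) / (x - e)" for c
    using xe by (simp add: divide_simps)
  then have 1: "1 - u = (x - a) / (x - e)" "1 - v = (x - 1 / cnj a) / (x - e)"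
    by (simp_all only: u_def v_def)
  show "norm (1 - u) \<le> norm (1 - v)"
    using norm_diff_le_norm_diff_inverse_cnj[OF a(2) x a0] 1
    by (simp only: norm_divide) (intro divide_right_mono, auto)
  show "norm (1 - v) = norm (x - 1 / cnj a) / norm (x - e)"
    by (simp only: 1 norm_divide)
  have "norm (1 / cnj a) > 1"
    using a a0 by (simp add: norm_inverse_cnj)
  then have "x - 1 / cnj a \<noteq> 0"
    using x by auto
  then show "v \<noteq> 1"
    using 1(2) xe by auto
qed

text \<open>With \<open>M = 4 * norm (a - e) / D\<close>, the power \<open>M powr \<rho>\<close>
  supplies \<open>D powr \<rho>\<close> in the denominator, and the bound on \<open>u - v\<close>
  supplies one more \<open>D\<close>. The linear factor has modulus at most
  \<open>1\<close>.\<close>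

lemma norm_disc_factor_le:
  assumes a: "norm a < 1" and e: "norm e = 1" and x: "norm x < 1"
    and D: "0 < D" "D \<le> norm (x - e)"
    and \<rho>: "real p - 1 \<le> \<rho>" "\<rho> \<le> real p" "\<rho> > 0"
  shows "norm (disc_factor p e a x)
    \<le> exp (3 * 4 powr \<rho> * (2 * exp 2 + real p * 2 powr \<rho>) * ((1 - norm a) * norm (a - e) powr \<rho>) / D powr (\<rho> + 1))"
proof (cases "norm a < 1 / 2")
  case True
  have "norm (disc_factor p e a x) \<le> 1"
    using True norm_triangle_ineq4[of x a] a x by (simp add: disc_factor_def norm_divide)
  also have "\<dots> \<le> exp (3 * 4 powr \<rho> * (2 * exp 2 + real p * 2 powr \<rho>) * ((1 - norm a) * norm (a - e) powr \<rho>) / D powr (\<rho> + 1))"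
    using a by simp
  finally show ?thesis .
next
  case False
  then have a': "1 / 2 \<le> norm a" by simp
  define u v where "u = (a - e) / (x - e)" and "v = (1 / cnj a - e) / (x - e)"
  define M where "M = 4 * norm (a - e) / D"
  note geometry = norm_quotient_zero_le[OF a' a e x D] norm_quotient_pole_le[OF a' a e x D]
    norm_quotient_diff_le[OF a' a e x D] norm_one_minus_quotient_le[OF a' a e x D]
    quotient_pole_neq_1[OF a' a e x D]
  have "a \<noteq> e" using a e by auto
  then have "M > 0" using D by (simp add: M_def)
  have "norm (disc_factor p e a x) = norm (weierstrass_factor p u / weierstrass_factor p v)"
    using False by (simp add: disc_factor_def u_def v_def)
  also have "\<dots> \<le> exp ((2 * exp 2 + real p * 2 powr \<rho>) * M powr \<rho> * norm (u - v))"
    using geometry \<open>M > 0\<close> \<rho> unfolding u_def[symmetric] v_def[symmetric] M_def[symmetric]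
    by (intro norm_weierstrass_factor_quotient_le) auto
  also have "\<dots> \<le> exp ((2 * exp 2 + real p * 2 powr \<rho>) * M powr \<rho> * (3 * (1 - norm a) / D))"
    using geometry(3) by (simp only: u_def v_def exp_le_cancel_iff) (intro mult_left_mono, auto)
  also have "(2 * exp 2 + real p * 2 powr \<rho>) * M powr \<rho> * (3 * (1 - norm a) / D)
      = 3 * 4 powr \<rho> * (2 * exp 2 + real p * 2 powr \<rho>) * ((1 - norm a) * norm (a - e) powr \<rho>) / D powr (\<rho> + 1)"
    using D by (simp add: M_def powr_divide powr_mult powr_add)
  finally show ?thesis .
qed

text \<open>Gives locally uniform convergence of the product: \<open>B\<close> depends on
  \<open>r\<close>, \<open>p\<close> and \<open>\<rho>\<close>, but not on \<open>a\<close> or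
  \<open>e\<close>. On a fixed smaller disc \<open>M\<close> stays bounded, so one quotient estimate
  covers all zeros off the centre.\<close>

lemma disc_factor_minus_1_le:
  assumes r: "r < 1" and \<rho>: "\<rho> \<le> real p" "\<rho> > 0"
  obtains B where "B \<ge> 0" "\<And>a e x. \<lbrakk>norm a < 1; norm e = 1; norm x \<le> r\<rbrakk> \<Longrightarrow>
    norm (disc_factor p e a x - 1) \<le> B * ((1 - norm a) * norm (a - e) powr \<rho>)"
proof -
  define s where "s = 1 - r"
  have s: "s > 0" using r by (simp add: s_def)
  \<comment> \<open>For \<open>norm a < 1 / 2\<close> the left side is at most \<open>2\<close>,
    while the weight is at least \<open>(1 / 2) * (1 / 2) powr \<rho>\<close>.\<close>
  define B1 where "B1 = 4 * 2 powr \<rho>"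
  define B2 where "B2 = 2 ^ p * (4 / s) ^ p * exp (2 * (\<Sum>k=1..p. (8 / s) ^ k)) / (s / 2) * (3 / s)"
  have B: "B1 \<ge> 0" "B2 \<ge> 0"
    using s by (auto simp: B1_def B2_def)
  have main: "norm (disc_factor p e a x - 1) \<le> (B1 + B2) * ((1 - norm a) * norm (a - e) powr \<rho>)"
    if a: "norm a < 1" and e: "norm e = 1" and xr: "norm x \<le> r" for a e x
  proof -
    define d where "d = norm (a - e)"
    have d: "1 - norm a \<le> d" "d \<le> 2"
      using norm_triangle_ineq2[of e a] norm_triangle_ineq4[of a e] a e
      by (auto simp: d_def norm_minus_commute)
    have d0: "d > 0" using d a by linarith
    have x: "norm x < 1" using xr r by simp
    show ?thesis
    proof (cases "norm a < 1 / 2")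
      case True
      have "norm (disc_factor p e a x - 1) \<le> norm ((x - a) / 2) + norm (1::complex)"
        using True by (simp only: disc_factor_def if_True) (rule norm_triangle_ineq4)
      also have "\<dots> \<le> 2"
        using norm_triangle_ineq4[of x a] a x by (simp add: norm_divide)
      also have "2 = B1 * ((1 / 2) * (1 / 2) powr \<rho>)"
        by (simp add: B1_def powr_divide)
      also have "\<dots> \<le> B1 * ((1 - norm a) * d powr \<rho>)"
        using True d \<rho> B by (intro mult_left_mono mult_mono powr_mono2) auto
      also have "\<dots> \<le> (B1 + B2) * ((1 - norm a) * d powr \<rho>)"
        using a B by (intro mult_right_mono) auto
      finally show ?thesis by (simp add: d_def)
    next
      case False
      then have a': "1 / 2 \<le> norm a" by simp
      have D: "s \<le> norm (x - e)"
        using norm_triangle_ineq2[of e x] e xr by (simp add: s_def norm_minus_commute)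
      define u v where "u = (a - e) / (x - e)" and "v = (1 / cnj a - e) / (x - e)"
      define M where "M = 4 * d / s"
      note geometry = norm_quotient_zero_le[OF a' a e x s D] norm_quotient_pole_le[OF a' a e x s D]
        norm_quotient_diff_le[OF a' a e x s D] norm_one_minus_pole_eq[OF a' a e x s D]
      have M: "0 < M" "M \<le> 8 / s"
        using d d0 s by (auto simp: M_def field_simps)
      have pole: "s \<le> norm (x - 1 / cnj a)"
      proof -
        have "1 \<le> norm (1 / cnj a)"
          using a a' unfolding norm_inverse_cnj by (subst le_divide_eq_1_pos) linarith+
        then show ?thesis
          using norm_triangle_ineq2[of "1 / cnj a" x] xr by (simp add: s_def norm_minus_commute)
      qed
      have "norm (x - e) \<le> 2"
        using norm_triangle_ineq4[of x e] x e by simp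
      \<comment> \<open>The reflected point lies outside the unit disc, hence at distance at least
        \<open>s\<close> from \<open>x\<close>.\<close>
      then have "s / 2 \<le> norm (1 - v)"
        unfolding v_def geometry(4) using pole s D by (intro frac_le) auto
      then have "norm (weierstrass_factor p u / weierstrass_factor p v - 1)
          \<le> M ^ p * exp (2 * (\<Sum>k=1..p. M ^ k)) / (s / 2) * norm (u - v)"
        using geometry(1,2) s unfolding u_def[symmetric] v_def[symmetric] d_def[symmetric] M_def[symmetric]
        by (intro norm_weierstrass_factor_quotient_minus_1_le) auto
      also have "\<dots> \<le> (2 ^ p * (4 / s) ^ p * d powr \<rho>) * exp (2 * (\<Sum>k=1..p. (8 / s) ^ k)) / (s / 2)
          * (3 * (1 - norm a) / s)"
      proof (intro mult_mono divide_right_mono)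
        \<comment> \<open>Only \<open>d \<le> 2\<close> is known, so \<open>d\<close> is halved
          before the exponent is lowered from \<open>p\<close> to \<open>\<rho>\<close>.\<close>
        have "d ^ p = 2 ^ p * (d / 2) ^ p"
          by (simp add: power_divide)
        also have "\<dots> \<le> 2 ^ p * (d / 2) powr \<rho>"
          using d d0 \<rho> powr_mono'[of \<rho> "real p" "d / 2"] by (simp add: powr_realpow)
        also have "\<dots> \<le> 2 ^ p * d powr \<rho>"
          using d0 \<rho> by (intro mult_left_mono powr_mono2) auto
        finally have "d ^ p * (4 / s) ^ p \<le> 2 ^ p * d powr \<rho> * (4 / s) ^ p"
          using s by (intro mult_right_mono) auto
        then show "M ^ p \<le> 2 ^ p * (4 / s) ^ p * d powr \<rho>"
          by (simp add: M_def mult_ac flip: power_mult_distrib)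
        show "exp (2 * (\<Sum>k=1..p. M ^ k)) \<le> exp (2 * (\<Sum>k=1..p. (8 / s) ^ k))"
          using M by (simp only: exp_le_cancel_iff) (intro mult_left_mono sum_mono power_mono, auto)
        show "norm (u - v) \<le> 3 * (1 - norm a) / s"
          using geometry(3) by (simp add: u_def v_def)
      qed (use s in auto)
      also have "\<dots> = B2 * ((1 - norm a) * d powr \<rho>)"
        by (simp add: B2_def)
      also have "\<dots> \<le> (B1 + B2) * ((1 - norm a) * d powr \<rho>)"
        using a B by (intro mult_right_mono) auto
      finally show ?thesis
        using False by (simp add: disc_factor_def u_def v_def d_def)
    qed
  qed
  show thesis
    by (rule that[of "B1 + B2"]) (use B main in auto)
qed

text \<open>Since \<open>1 - u = (x - a) / (x - e)\<close>, the numerator contains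
  \<open>x - a\<close> exactly once; the remaining exponential, \<open>x - e\<close> and the
  denominator have no zeros in the disc.\<close>

lemma disc_factor_simple_zero:
  assumes a: "norm a < 1" and e: "norm e = 1"
  obtains h where "h holomorphic_on ball 0 1" "\<And>x. x \<in> ball 0 1 \<Longrightarrow> h x \<noteq> 0"
    "\<And>x. x \<in> ball 0 1 \<Longrightarrow> disc_factor p e a x = (x - a) * h x"
proof (cases "norm a < 1 / 2")
  case True
  show thesis
    by (rule that[of "\<lambda>_. 1 / 2"]) (use True in \<open>auto simp: disc_factor_def\<close>)
next
  case False
  define h where "h = (\<lambda>x. exp (weierstrass_exponent p ((a - e) / (x - e))) /
    ((x - e) * weierstrass_factor p ((1 / cnj a - e) / (x - e))))"
  have nz: "x - e \<noteq> 0" "weierstrass_factor p ((1 / cnj a - e) / (x - e)) \<noteq> 0" if "x \<in> ball 0 1" for x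
  proof -
    show "x - e \<noteq> 0" using that e by auto
    then show "weierstrass_factor p ((1 / cnj a - e) / (x - e)) \<noteq> 0"
      using quotient_pole_neq_1[of a e x "norm (x - e)"] False a e that by simp
  qed
  show thesis
  proof (rule that[of h])
    show "h holomorphic_on ball 0 1"
      unfolding h_def using nz by (intro holomorphic_intros) auto
    show "h x \<noteq> 0" if "x \<in> ball 0 1" for x
      using nz[OF that] by (simp add: h_def)
    show "disc_factor p e a x = (x - a) * h x" if "x \<in> ball 0 1" for x
    proof -
      have "1 - (a - e) / (x - e) = (x - a) / (x - e)"
        using nz(1)[OF that] by (simp add: divide_simps)
      then show ?thesis
        using False by (simp add: disc_factor_def h_def weierstrass_factor_eq[of p "(a - e) / (x - e)"])
    qed
  qed
qed

section \<open>Zeros of infinite products\<close>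

text \<open>The majorant may vary with the disc. In the application it is a fixed summable sequence
  times a constant depending on the disc.\<close>

locale locally_summable_product =
  fixes S :: "complex set" and g :: "nat \<Rightarrow> complex \<Rightarrow> complex"
  assumes open_S: "open S"
    and holomorphic: "\<And>n. g n holomorphic_on S"
    and locally_summable: "\<And>w. w \<in> S \<Longrightarrow> \<exists>r>0. cball w r \<subseteq> S \<and>
      (\<exists>m. summable m \<and> (\<forall>n. \<forall>x\<in>cball w r. norm (g n x - 1) \<le> m n))"
begin

lemma summable_at:
  assumes "x \<in> S"
  shows "summable (\<lambda>n. norm (g n x - 1))"
proof -
  obtain r m where m: "r > 0" "summable m" "\<And>n y. y \<in> cball x r \<Longrightarrow> norm (g n y - 1) \<le> m n"
    using locally_summable[OF assms] by blast
  from m(2) show ?thesis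
    by (rule summable_comparison_test') (use m in simp)
qed

lemma convergent_prod_at: "x \<in> S \<Longrightarrow> convergent_prod (\<lambda>n. g n x)"
  by (intro abs_convergent_prod_imp_convergent_prod summable_imp_abs_convergent_prod summable_at)

lemma holomorphic_prodinf: "(\<lambda>x. \<Prod>n. g n x) holomorphic_on S"
proof (rule holomorphic_uniform_sequence[OF open_S])
  show "(\<lambda>x. \<Prod>n<N. g n x) holomorphic_on S" for N
    by (rule holomorphic_on_prod) (rule holomorphic)
  fix w assume "w \<in> S"
  obtain r m where r: "r > 0" "cball w r \<subseteq> S" and m: "summable m"
    "\<And>n x. x \<in> cball w r \<Longrightarrow> norm (g n x - 1) \<le> m n"
    using locally_summable[OF \<open>w \<in> S\<close>] by blast
  have "uniformly_convergent_on (cball w r) (\<lambda>N x. \<Sum>n<N. norm (g n x - 1))"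
    by (rule Weierstrass_m_test'[OF _ m(1)]) (use m(2) in simp)
  then have "uniformly_convergent_on (cball w r) (\<lambda>N x. \<Prod>n<N. g n x)"
    using r holomorphic
    by (intro uniformly_convergent_on_prod')
       (auto intro!: holomorphic_on_imp_continuous_on intro: holomorphic_on_subset)
  then obtain l where l: "uniform_limit (cball w r) (\<lambda>N x. \<Prod>n<N. g n x) l sequentially"
    by (auto simp: uniformly_convergent_on_def)
  \<comment> \<open>Uniform convergence only provides some limit function; pointwise it must be the
    infinite product.\<close>
  have "l x = (\<Prod>n. g n x)" if "x \<in> cball w r" for x
  proof (rule LIMSEQ_unique)
    show "(\<lambda>N. \<Prod>n<N. g n x) \<longlonglongrightarrow> l x"
      using l that by (rule tendsto_uniform_limitI)
    have "convergent_prod (\<lambda>n. g n x)"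
      using that r by (intro convergent_prod_at) auto
    then show "(\<lambda>N. \<Prod>n<N. g n x) \<longlonglongrightarrow> (\<Prod>n. g n x)"
      by (intro has_prod_imp_tendsto' convergent_prod_has_prod)
  qed
  then have "uniform_limit (cball w r) (\<lambda>N x. \<Prod>n<N. g n x) (\<lambda>x. \<Prod>n. g n x) sequentially"
    using l by (subst uniform_limit_cong'[where g = "\<lambda>N x. \<Prod>n<N. g n x" and i = l]) auto
  then show "\<exists>d>0. cball w d \<subseteq> S \<and>
      uniform_limit (cball w d) (\<lambda>N x. \<Prod>n<N. g n x) (\<lambda>x. \<Prod>n. g n x) sequentially"
    using r by blast
qed

lemma shift: "locally_summable_product S (\<lambda>n. g (n + N))"
proof
  fix w assume "w \<in> S"
  obtain r m where r: "r > 0" "cball w r \<subseteq> S" and m: "summable m"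
    "\<And>n x. x \<in> cball w r \<Longrightarrow> norm (g n x - 1) \<le> m n"
    using locally_summable[OF \<open>w \<in> S\<close>] by blast
  have "summable (\<lambda>n. m (n + N))"
    using m(1) by (rule summable_ignore_initial_segment)
  then show "\<exists>r>0. cball w r \<subseteq> S \<and>
      (\<exists>m. summable m \<and> (\<forall>n. \<forall>x\<in>cball w r. norm (g (n + N) x - 1) \<le> m n))"
    using r m(2) by blast
qed (use open_S holomorphic in auto)

lemma finite_zero_factors:
  assumes "x \<in> S"
  shows "finite {n. g n x = 0}"
proof -
  have "eventually (\<lambda>n. norm (g n x - 1) < 1) sequentially"
    using summable_LIMSEQ_zero[OF summable_at[OF assms]] by (rule order_tendstoD) simp
  then obtain N where "\<And>n. n \<ge> N \<Longrightarrow> norm (g n x - 1) < 1"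
    by (auto simp: eventually_sequentially)
  then have "{n. g n x = 0} \<subseteq> {..<N}"
    by (force simp: not_le[symmetric])
  then show ?thesis
    using finite_subset by blast
qed

text \<open>Beyond some \<open>N\<close> no factor vanishes at \<open>w\<close>. Each of the
  finitely many vanishing factors gives one \<open>x - w\<close>, and the cofactor \<open>q\<close>,
  made of the rest and the tail, is nonzero at \<open>w\<close>.\<close>

lemma zorder_prodinf:
  assumes w: "w \<in> S" and J: "J = {n. g n w = 0}"
    and simple: "\<And>n. n \<in> J \<Longrightarrow> \<exists>h. h holomorphic_on S \<and> h w \<noteq> 0 \<and> (\<forall>x\<in>S. g n x = (x - w) * h x)"
  shows "zorder (\<lambda>x. \<Prod>n. g n x) w = int (card J)"
proof -
  obtain h where h: "\<And>n. n \<in> J \<Longrightarrow> h n holomorphic_on S" "\<And>n. n \<in> J \<Longrightarrow> h n w \<noteq> 0"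
    "\<And>n x. n \<in> J \<Longrightarrow> x \<in> S \<Longrightarrow> g n x = (x - w) * h n x"
    using simple by metis
  have fin: "finite J"
    using finite_zero_factors[OF w] by (simp add: J)
  then obtain N where N: "J \<subseteq> {..<N}"
    using finite_nat_iff_bounded by blast
  interpret tail: locally_summable_product S "\<lambda>n. g (n + N)"
    by (rule shift)
  define q where "q = (\<lambda>x. (\<Prod>n\<in>J. h n x) * (\<Prod>n\<in>{..<N} - J. g n x) * (\<Prod>n. g (n + N) x))"
  show ?thesis
  proof (rule zorder_eqI[OF open_S w])
    show "q holomorphic_on S"
      unfolding q_def by (intro holomorphic_intros h holomorphic tail.holomorphic_prodinf)
    have "(\<Prod>n. g (n + N) w) \<noteq> 0"
      using N by (intro prodinf_nonzero tail.convergent_prod_at w) (auto simp: J)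
    then show "q w \<noteq> 0"
      using fin h(2) by (auto simp: q_def J)
    fix x assume x: "x \<in> S"
    have "(\<lambda>n. g n x) has_prod ((\<Prod>n<N. g n x) * (\<Prod>n. g (n + N) x))"
      by (intro has_prod_ignore_initial_segment' convergent_prod_at x)
    then have "(\<Prod>n. g n x) = (\<Prod>n<N. g n x) * (\<Prod>n. g (n + N) x)"
      using has_prod_unique by metis
    also have "(\<Prod>n<N. g n x) = (\<Prod>n\<in>{..<N} - J. g n x) * (\<Prod>n\<in>J. g n x)"
      using N by (intro prod.subset_diff) auto
    also have "(\<Prod>n\<in>J. g n x) = (x - w) ^ card J * (\<Prod>n\<in>J. h n x)"
      using h(3) x by (simp add: prod.distrib)
    finally show "(\<Prod>n. g n x) = q x * (x - w) powi int (card J)"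
      by (simp add: q_def)
  qed
qed

text \<open>Here \<open>m\<close> bounds the logarithms of the moduli at the single point
  \<open>x\<close>, independently of the majorants used for convergence.\<close>

lemma norm_prodinf_le_exp:
  assumes x: "x \<in> S" and m: "summable m" "\<And>n. m n \<ge> 0" "\<And>n. norm (g n x) \<le> exp (m n)"
  shows "norm (\<Prod>n. g n x) \<le> exp (\<Sum>n. m n)"
proof (rule LIMSEQ_le_const2)
  show "(\<lambda>N. norm (\<Prod>n<N. g n x)) \<longlonglongrightarrow> norm (\<Prod>n. g n x)"
    by (intro tendsto_norm has_prod_imp_tendsto' convergent_prod_has_prod convergent_prod_at x)
  have "norm (\<Prod>n<N. g n x) \<le> exp (\<Sum>n. m n)" for N
  proof -
    have "norm (\<Prod>n<N. g n x) \<le> (\<Prod>n<N. exp (m n))"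
      unfolding prod_norm[symmetric] by (intro prod_mono) (auto intro: m)
    also have "\<dots> = exp (\<Sum>n<N. m n)"
      by (simp add: exp_sum)
    also have "\<dots> \<le> exp (\<Sum>n. m n)"
      using m by (auto intro!: sum_le_suminf)
    finally show ?thesis .
  qed
  then show "\<exists>N. \<forall>n\<ge>N. norm (\<Prod>k<n. g k x) \<le> exp (\<Sum>n. m n)"
    by blast
qed

end

section \<open>Assembly of the function from its factors\<close>

theorem theorem1:
  fixes E :: "complex set" and \<rho> :: real and z :: "nat \<Rightarrow> complex" and I :: "nat set"
  assumes "E \<noteq> {}" and "closed E" and "E \<subseteq> sphere 0 1"
    and "\<rho> > 0"
    and "\<And>n. n \<in> I \<Longrightarrow> z n \<in> ball 0 1"
    and "(\<lambda>n. (1 - norm (z n)) * infdist (z n) E powr \<rho>) summable_on I"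
  shows "\<exists>f \<in> growth_class (\<rho> + 1) E. zeros_in_disc_are f z I"
proof -
  define p where "p = nat \<lceil>\<rho>\<rceil>"
  have p: "real p - 1 \<le> \<rho>" "\<rho> \<le> real p"
    using \<open>\<rho> > 0\<close> unfolding p_def by linarith+
  have "\<exists>e\<in>E. infdist (z n) E = dist (z n) e" for n
    using infdist_attains_inf[OF assms(2,1)] by metis
  then obtain e where e: "\<And>n. e n \<in> E" "\<And>n. infdist (z n) E = norm (z n - e n)"
    unfolding dist_norm by metis
  have e1: "norm (e n) = 1" for n
    using e(1)[of n] assms(3) by auto
  have infdist_le: "infdist x E \<le> norm (x - e n)" for x n
    using infdist_le[OF e(1), of x n] by (simp add: dist_norm)
  have infdist_pos: "infdist x E > 0" if "x \<in> ball 0 1" for x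
  proof -
    have "x \<notin> E" using that assms(3) by auto
    then show ?thesis
      using assms(1,2) in_closed_iff_infdist_zero infdist_nonneg less_eq_real_def by metis
  qed
  \<comment> \<open>Weights \<open>0\<close>, and below factors \<open>1\<close>, outside
    \<open>I\<close> turn the family into a sequence over all naturals, whether \<open>I\<close> is
    finite or infinite.\<close>
  define A where "A = (\<lambda>n. if n \<in> I then (1 - norm (z n)) * norm (z n - e n) powr \<rho> else 0)"
  have A0: "A n \<ge> 0" for n
    using assms(5)[of n] by (auto simp: A_def)
  have "A summable_on UNIV \<longleftrightarrow> (\<lambda>n. (1 - norm (z n)) * infdist (z n) E powr \<rho>) summable_on I"
    by (rule summable_on_cong_neutral) (auto simp: A_def e(2))
  then have A: "summable A"
    using assms(6) A0 by (simp add: summable_on_UNIV_nonneg_real_iff)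
  define g where "g = (\<lambda>n x. if n \<in> I then disc_factor p (e n) (z n) x else 1)"
  have simple: "\<exists>h. h holomorphic_on ball 0 1 \<and> (\<forall>x\<in>ball 0 1. h x \<noteq> 0) \<and>
      (\<forall>x\<in>ball 0 1. g n x = (x - z n) * h x)" if n: "n \<in> I" for n
  proof -
    obtain h where "h holomorphic_on ball 0 1" "\<And>x. x \<in> ball 0 1 \<Longrightarrow> h x \<noteq> 0"
      "\<And>x. x \<in> ball 0 1 \<Longrightarrow> disc_factor p (e n) (z n) x = (x - z n) * h x"
      using disc_factor_simple_zero[of "z n" "e n" p] assms(5)[OF n] e1 by auto
    then show ?thesis
      using n by (auto simp: g_def)
  qed
  interpret locally_summable_product "ball 0 1" g
  proof
    show "g n holomorphic_on ball 0 1" for n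
    proof (cases "n \<in> I")
      case True
      then obtain h where h: "h holomorphic_on ball 0 1" "\<forall>x\<in>ball 0 1. g n x = (x - z n) * h x"
        using simple by blast
      have "(\<lambda>x. (x - z n) * h x) holomorphic_on ball 0 1"
        by (intro holomorphic_intros h)
      then show ?thesis
        using h(2) by (subst holomorphic_cong[OF refl]) auto
    qed (simp add: g_def)
    fix w :: complex assume w: "w \<in> ball 0 1"
    define r where "r = (1 - norm w) / 2"
    have r: "r > 0" "norm w + r < 1" using w by (auto simp: r_def field_simps)
    obtain B where B: "B \<ge> 0" "\<And>a e x. \<lbrakk>norm a < 1; norm e = 1; norm x \<le> norm w + r\<rbrakk> \<Longrightarrow>
        norm (disc_factor p e a x - 1) \<le> B * ((1 - norm a) * norm (a - e) powr \<rho>)"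
      using disc_factor_minus_1_le[OF r(2) p(2) \<open>\<rho> > 0\<close>] by metis
    have sub: "norm x \<le> norm w + r" if "x \<in> cball w r" for x
      using that norm_triangle_ineq2[of x w] by (simp add: dist_norm norm_minus_commute)
    have "norm (g n x - 1) \<le> B * A n" if "x \<in> cball w r" for n x
      using B(2)[OF _ e1 sub[OF that], of "z n"] assms(5)[of n] by (auto simp: g_def A_def)
    moreover have "cball w r \<subseteq> ball 0 1"
      using sub r(2) by fastforce
    ultimately show "\<exists>r>0. cball w r \<subseteq> ball 0 1 \<and>
        (\<exists>m. summable m \<and> (\<forall>n. \<forall>x\<in>cball w r. norm (g n x - 1) \<le> m n))"
      using r(1) summable_mult[OF A, of B] by (intro exI[of _ r]) blast
  qed auto
  define f where "f = (\<lambda>x. \<Prod>n. g n x)"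
  have zero_iff: "g n x = 0 \<longleftrightarrow> n \<in> I \<and> z n = x" if "x \<in> ball 0 1" for n x
  proof (cases "n \<in> I")
    case True
    then show ?thesis
      using simple[OF True] that by auto
  qed (auto simp: g_def)
  define c where "c = 3 * 4 powr \<rho> * (2 * exp 2 + real p * 2 powr \<rho>)"
  have "c \<ge> 0"
    by (simp add: c_def)
  \<comment> \<open>The summand \<open>1\<close> keeps the constant strictly positive, as
    \<open>growth_class\<close> demands, even if all weights vanish.\<close>
  have growth: "norm (f x) \<le> exp ((c * suminf A + 1) / infdist x E powr (\<rho> + 1))" if x: "x \<in> ball 0 1" for x
  proof -
    define t where "t = infdist x E powr (\<rho> + 1)"
    have t: "t > 0" using infdist_pos[OF x] by (simp add: t_def)
    have "norm (f x) \<le> exp (\<Sum>n. c / t * A n)"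
      unfolding f_def
    proof (rule norm_prodinf_le_exp[OF x])
      show "summable (\<lambda>n. c / t * A n)"
        by (intro summable_mult A)
      show "c / t * A n \<ge> 0" for n
        using \<open>c \<ge> 0\<close> A0 t by simp
      \<comment> \<open>Taken with \<open>D = infdist x E\<close>, a lower bound for the distances
        to all the points \<open>e n\<close> at once.\<close>
      show "norm (g n x) \<le> exp (c / t * A n)" for n
        using norm_disc_factor_le[of "z n" "e n" x "infdist x E" p \<rho>] p \<open>\<rho> > 0\<close> e1 x
          infdist_pos[OF x] infdist_le[of x n] assms(5)[of n]
        by (auto simp: g_def A_def c_def t_def)
    qed
    also have "(\<Sum>n. c / t * A n) = c * suminf A / t"
      using suminf_mult[OF A, of "c / t"] by simp
    also have "\<dots> \<le> (c * suminf A + 1) / t"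
      using t by (intro divide_right_mono) auto
    finally show ?thesis
      by (simp add: t_def)
  qed
  have "c * suminf A + 1 > 0"
    using suminf_nonneg[OF A A0] \<open>c \<ge> 0\<close> by (simp add: add_nonneg_pos)
  then have "f \<in> growth_class (\<rho> + 1) E"
    using growth holomorphic_prodinf unfolding growth_class_def f_def by blast
  moreover have "zeros_in_disc_are f z I"
    unfolding zeros_in_disc_are_def
  proof (intro conjI ballI)
    \<comment> \<open>Countably many prescribed zeros cannot fill the disc, so at some point no
      factor vanishes.\<close>
    have "uncountable (ball 0 1 :: complex set)"
      by (rule uncountable_ball) simp
    then have "\<not> ball 0 1 \<subseteq> range z"
      using countable_subset[of "ball 0 1" "range z"] by auto
    then obtain w where w: "w \<in> ball 0 1" "w \<notin> range z"
      by blast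
    then have "f w \<noteq> 0"
      unfolding f_def by (intro prodinf_nonzero convergent_prod_at) (auto simp: zero_iff)
    then show "\<exists>w\<in>ball 0 1. f w \<noteq> 0"
      using w by blast
  next
    fix w :: complex assume w: "w \<in> ball 0 1"
    have J: "{n \<in> I. z n = w} = {n. g n w = 0}"
      using zero_iff[OF w] by auto
    show "finite {n \<in> I. z n = w}"
      unfolding J by (rule finite_zero_factors[OF w])
    show "zorder f w = int (card {n \<in> I. z n = w})"
      unfolding f_def
    proof (rule zorder_prodinf[OF w J])
      fix n assume "n \<in> {n \<in> I. z n = w}"
      then show "\<exists>h. h holomorphic_on ball 0 1 \<and> h w \<noteq> 0 \<and> (\<forall>x\<in>ball 0 1. g n x = (x - w) * h x)"
        using simple[of n] w by blast
    qed
  qed (use assms(5) in auto)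
  ultimately show ?thesis
    by blast
qed

end
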